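(* Suppose treatments are assigned by the following randomized saturation design. For all $i\in\mathcal{N}_n$, $Y_i(\cdot)$ is independent of $\bm{D}$. The clusters $\{C_j\}_{j=1}^m$ are a partition of $\mathcal{N}_n$, and the saturation levels $\{\tilde S_j\}_{j=1}^m$ are i.i.d. draws from a distribution supported on $\mathcal{P}=\{p_k\}_{k=1}^q\subseteq[0,1]$. For each $j$, the treatments $\{D_i\}_{i\in C_j}$ are i.i.d. $\text{Bernoulli}(p)$ conditional on $\tilde S_j=p$. Let $p,p'\in\mathcal{P}$ with $p\ge p'$, and let $\tau(t,t')$ be one of the following: (indirect effect) $t=(d,p)$, $t'=(d,p')$ for any $d\in\{0,1\}$; (total effect) $t=(1,p)$, $t'=(0,p')$; (overall effect) $t=(\emptyset,p)$, $t'=(\emptyset,p')$, where the event $\{D_i=\emptyset\}$ is defined to be $\{D_i\in\{0,1\}\}$ (so the contrast varies the saturation level without conditioning on $D_i$). Assume overlap: the conditional distribution of $\bm{D}$ given $T_i=s$ exists for all $i\in\mathcal{N}_n$ and $s\in\{t,t'\}$. Then for all $i\in\mathcal{N}_n$ there exists a monotone coupling $\bm{D}_{(i),t}^*\ge\bm{D}_{(i),t'}^*$ almost surely, independent of $\bm{D}_{(-i)}$, with $\bm{D}_{(i),s}^*\sim p_{(i),s}(\cdot)$ for all $s\in\{t,t'\}$, such that $$\tau(t,t')=\frac1n\sum_{i=1}^n\mathbf{E}\big[Y_i(\bm{D}_{(i),t}^*,\bm{D}_{(-i)})-Y_i(\bm{D}_{(i),t'}^*,\bm{D}_{(-i)}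)\big].$$
   Context: There are $n$ units, $\mathcal{N}_n=\{1,\dots,n\}$. $\bm{D}=(D_i)_{i=1}^n\in\{0,1\}^n$ is the random treatment assignment vector. For each $i$, $Y_i(\cdot)$ is a (potentially) random map $\{0,1\}^n\to\mathbb{R}$ of potential outcomes, and the observed outcome is $Y_i=Y_i(\bm{D})$; no restriction is imposed on how $Y_i(\bm{d})$ depends on $\bm{d}$, within or across clusters. In words, the design randomly assigns clusters to saturation levels and assigns units within a cluster to treatment with probability equal to the saturation level; treatments are independent across clusters. $S_i$ is the saturation level of unit $i$'s cluster: $S_i=\tilde S_j$ if $i\in C_j$. The exposure is $T_i=(D_i,S_i)$. There are no control variables, and the exposure contrast is $$\tau(t,t')=\frac1n\sum_{i=1}^n\big(\mathbf{E}[Y_i\mid T_i=t]-\mathbf{E}[Y_i\mid T_i=t']\big).$$ $C_{(i)}$ denotes the cluster containing $i$; for $\bm{d}\in\{0,1\}^n$, $\bm{d}_{(i)}=(d_j)_{j\in C_{(i)}}$ and $\bm{d}_{(-i)}=(d_j)_{j\in\mathcal{N}_n\setminus C_{(i)}}$, and $Y_i(\bm{d}_{(i)},\bm{d}_{(-i)})$ means $Y_i(\bm{d})$. $p_{(i),s}(\cdot)$ is the conditional distribution of $\bm{D}_{(i)}$ given $T_i=s$. A monotone coupling here means random vectors in $\{0,1\}^{|C_{(i)}|}$ defined on a common probability space and ordered componentwise almost surely.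
   Formalization: Each Y_i(·) is assumed independent of the pair (D, S_i), not of D alone (the claim fails otherwise); saturation–treatment pairs are independent across clusters, and the conditional means of Y_i given T_i = t, t' are assumed to exist. *)

theory Defs
  imports "HOL-Probability.Probability"
begin

text \<open>
  The units are the elements of a finite type \<open>'n\<close>, so \<open>n = CARD('n)\<close>, and treatment vectors in
  \<open>{0,1}^n\<close> are functions \<open>'n \<Rightarrow> bool\<close> (\<open>True\<close> is treated; \<open>False \<le> True\<close>).  The subvector of \<open>d\<close>
  with coordinates in \<open>A\<close> is \<open>restrict d A\<close>.  All sets of treatment vectors are finite, hence the
  discrete sigma-algebra \<open>count_space UNIV\<close>.

  Parameters: \<open>C j\<close> and \<open>St j\<close> are the \<open>j\<close>-th cluster and its saturation level (\<open>j \<in> {1..m}\<close>), \<open>D\<close>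
  is the assignment vector and \<open>Y i \<omega> d\<close> is the potential outcome of unit \<open>i\<close> under assignment \<open>d\<close>.
\<close>

text \<open>The library's \<open>indep_var\<close> requires both variables to take values in the same type; this is its
  unfolding for different types.\<close>

definition indep_rv ::
  "'a measure \<Rightarrow> 'b measure \<Rightarrow> ('a \<Rightarrow> 'b) \<Rightarrow> 'c measure \<Rightarrow> ('a \<Rightarrow> 'c) \<Rightarrow> bool"
  where "indep_rv M MX X MZ Z \<longleftrightarrow>
    X \<in> measurable M MX \<and> Z \<in> measurable M MZ \<and>
    prob_space.indep_set M {X -` A \<inter> space M | A. A \<in> sets MX} {Z -` B \<inter> space M | B. B \<in> sets MZ}"

definition cluster_index :: "nat \<Rightarrow> (nat \<Rightarrow> 'n set) \<Rightarrow> 'n \<Rightarrow> nat"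
  where "cluster_index m C i = (THE j. j \<in> {1..m} \<and> i \<in> C j)"

definition own_cluster :: "nat \<Rightarrow> (nat \<Rightarrow> 'n set) \<Rightarrow> 'n \<Rightarrow> 'n set"
  where "own_cluster m C i = C (cluster_index m C i)"

definition unit_saturation ::
  "nat \<Rightarrow> (nat \<Rightarrow> 'n set) \<Rightarrow> (nat \<Rightarrow> 'a \<Rightarrow> real) \<Rightarrow> 'n \<Rightarrow> 'a \<Rightarrow> real"
  where "unit_saturation m C St i \<omega> = St (cluster_index m C i) \<omega>"

text \<open>Independence of the pairs (saturation level, treatments of the cluster) is independence of
  treatments across clusters; independence of \<open>Y i\<close> from the design is required jointly for \<open>D\<close> and
  the saturation level of the unit's own cluster, since exposures are not functions of \<open>D\<close> alone.\<close>

locale randomized_saturation_design = prob_space M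
  for M :: "'a measure" +
  fixes m :: nat
    and C :: "nat \<Rightarrow> ('n::finite) set"
    and St :: "nat \<Rightarrow> 'a \<Rightarrow> real"
    and P :: "real set"
    and D :: "'a \<Rightarrow> 'n \<Rightarrow> bool"
    and Y :: "'n \<Rightarrow> 'a \<Rightarrow> ('n \<Rightarrow> bool) \<Rightarrow> real"
  assumes clusters: "partition_on UNIV (C ` {1..m})" "inj_on C {1..m}"
    and levels: "finite P" "P \<subseteq> {0..1}"
    and saturations_indep: "indep_vars (\<lambda>_. borel) St {1..m}"
    and saturations_ident: "\<exists>\<nu>. \<forall>j\<in>{1..m}. distr M borel (St j) = \<nu>"
    and saturations_supported: "\<forall>j\<in>{1..m}. AE \<omega> in M. St j \<omega> \<in> P"
    and clusters_indep:
      "indep_vars (\<lambda>_. borel \<Otimes>\<^sub>M count_space UNIV) (\<lambda>j \<omega>. (St j \<omega>, restrict (D \<omega>) (C j))) {1..m}"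
    and treatments_indep:
      "\<And>j p. j \<in> {1..m} \<Longrightarrow> p \<in> P \<Longrightarrow> prob {\<omega> \<in> space M. St j \<omega> = p} > 0 \<Longrightarrow>
         prob_space.indep_vars (uniform_measure M {\<omega> \<in> space M. St j \<omega> = p})
           (\<lambda>_. count_space UNIV) (\<lambda>i \<omega>. D \<omega> i) (C j)"
    and treatments_bernoulli:
      "\<And>j p i. j \<in> {1..m} \<Longrightarrow> p \<in> P \<Longrightarrow> prob {\<omega> \<in> space M. St j \<omega> = p} > 0 \<Longrightarrow> i \<in> C j \<Longrightarrow>
         distr (uniform_measure M {\<omega> \<in> space M. St j \<omega> = p}) (count_space UNIV) (\<lambda>\<omega>. D \<omega> i)
           = measure_pmf (bernoulli_pmf p)"
    and outcomes_indep:
      "\<And>i. indep_rv M (Pi\<^sub>M UNIV (\<lambda>_. borel)) (Y i)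
              (count_space UNIV \<Otimes>\<^sub>M borel) (\<lambda>\<omega>. (D \<omega>, unit_saturation m C St i \<omega>))"

text \<open>In an exposure value \<open>(d, p)\<close>, \<open>None\<close> stands for \<open>d = \<emptyset>\<close>.\<close>

definition exposure_event ::
  "'a measure \<Rightarrow> nat \<Rightarrow> (nat \<Rightarrow> 'n set) \<Rightarrow> (nat \<Rightarrow> 'a \<Rightarrow> real) \<Rightarrow> ('a \<Rightarrow> 'n \<Rightarrow> bool) \<Rightarrow>
     'n \<Rightarrow> bool option \<times> real \<Rightarrow> 'a set"
  where "exposure_event M m C St D i t = {\<omega> \<in> space M.
    (case fst t of None \<Rightarrow> True | Some d \<Rightarrow> D \<omega> i = d) \<and> unit_saturation m C St i \<omega> = snd t}"

definition given_exposure ::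
  "'a measure \<Rightarrow> nat \<Rightarrow> (nat \<Rightarrow> 'n set) \<Rightarrow> (nat \<Rightarrow> 'a \<Rightarrow> real) \<Rightarrow> ('a \<Rightarrow> 'n \<Rightarrow> bool) \<Rightarrow>
     'n \<Rightarrow> bool option \<times> real \<Rightarrow> 'a measure"
  where "given_exposure M m C St D i t = uniform_measure M (exposure_event M m C St D i t)"

definition exposure_contrast ::
  "'a measure \<Rightarrow> nat \<Rightarrow> (nat \<Rightarrow> 'n set) \<Rightarrow> (nat \<Rightarrow> 'a \<Rightarrow> real) \<Rightarrow> ('a \<Rightarrow> 'n::finite \<Rightarrow> bool) \<Rightarrow>
     ('n \<Rightarrow> 'a \<Rightarrow> ('n \<Rightarrow> bool) \<Rightarrow> real) \<Rightarrow> bool option \<times> real \<Rightarrow> bool option \<times> real \<Rightarrow> real"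
  where "exposure_contrast M m C St D Y t t' = 1 / real CARD('n) *
    (\<Sum>i\<in>UNIV. (\<integral>\<omega>. Y i \<omega> (D \<omega>) \<partial>given_exposure M m C St D i t)
             - (\<integral>\<omega>. Y i \<omega> (D \<omega>) \<partial>given_exposure M m C St D i t'))"

definition cluster_law ::
  "'a measure \<Rightarrow> nat \<Rightarrow> (nat \<Rightarrow> 'n set) \<Rightarrow> (nat \<Rightarrow> 'a \<Rightarrow> real) \<Rightarrow> ('a \<Rightarrow> 'n \<Rightarrow> bool) \<Rightarrow>
     'n \<Rightarrow> bool option \<times> real \<Rightarrow> ('n \<Rightarrow> bool) measure"
  where "cluster_law M m C St D i t =
    distr (given_exposure M m C St D i t) (count_space UNIV) (\<lambda>\<omega>. restrict (D \<omega>) (own_cluster m C i))"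

text \<open>The original probability space enriched by auxiliary randomness; random elements \<open>X\<close> of \<open>M\<close>
  become \<open>X \<circ> fst\<close> on \<open>M'\<close>, with the same joint laws.\<close>

definition extends_prob_space :: "'a measure \<Rightarrow> ('a \<times> 'b) measure \<Rightarrow> bool"
  where "extends_prob_space M M' \<longleftrightarrow>
    prob_space M' \<and> fst \<in> measurable M' M \<and> distr M' M fst = M"

end

theory Submission
  imports Defs
begin

text \<open>
  Enlarge \<open>M\<close> by independent uniform variables \<open>u j\<close>, one per unit.  The counterfactual cluster
  treatment of \<open>i\<close> under exposure \<open>(d, p)\<close> treats \<open>j\<close> iff \<open>u j \<le> p\<close>, except that unit \<open>i\<close> itself
  receives \<open>d\<close> if \<open>d\<close> is specified.  Using the same \<open>u\<close> for both exposures makes the coupling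
  monotone.  Given the exposure of \<open>i\<close>, the outcome map \<open>Y i\<close> keeps its law and stays independent of
  \<open>D\<close>, and the treatments outside the cluster keep their law and stay independent of those inside.
  Hence \<open>(Y i, D)\<close> given the exposure has the same law as \<open>Y i\<close> together with \<open>D\<close> after redrawing
  the cluster of \<open>i\<close>, and the conditional means agree with the means under the coupling.
\<close>

section \<open>Independence of random elements with different value types\<close>

lemma (in prob_space) indep_rv_iff:
  "indep_rv M MX X MZ Z \<longleftrightarrow> X \<in> measurable M MX \<and> Z \<in> measurable M MZ \<and>
    (\<forall>A\<in>sets MX. \<forall>B\<in>sets MZ. prob {\<omega>\<in>space M. X \<omega> \<in> A \<and> Z \<omega> \<in> B} =
       prob {\<omega>\<in>space M. X \<omega> \<in> A} * prob {\<omega>\<in>space M. Z \<omega> \<in> B})"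
proof (cases "X \<in> measurable M MX \<and> Z \<in> measurable M MZ")
  case True
  then have [measurable]: "X \<in> measurable M MX" "Z \<in> measurable M MZ" by auto
  have sub: "(\<lambda>A. X -` A \<inter> space M) ` sets MX \<subseteq> events" "(\<lambda>B. Z -` B \<inter> space M) ` sets MZ \<subseteq> events"
    by auto
  have "(X -` A \<inter> space M) \<inter> (Z -` B \<inter> space M) = {\<omega>\<in>space M. X \<omega> \<in> A \<and> Z \<omega> \<in> B}"
    "X -` A \<inter> space M = {\<omega>\<in>space M. X \<omega> \<in> A}" "Z -` B \<inter> space M = {\<omega>\<in>space M. Z \<omega> \<in> B}" for A B
    by auto
  note eqs = this
  show ?thesis
    using True sub unfolding indep_rv_def indep_sets2_eq Setcompr_eq_image Set.ball_simps(9) eqs(1)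
    unfolding eqs by meson
qed (auto simp: indep_rv_def)

lemma (in prob_space) indep_rv_compose:
  assumes ind: "indep_rv M MX X MZ Z" and f: "f \<in> measurable MX MV" and g: "g \<in> measurable MZ MW"
  shows "indep_rv M MV (\<lambda>\<omega>. f (X \<omega>)) MW (\<lambda>\<omega>. g (Z \<omega>))"
proof -
  have [measurable]: "X \<in> measurable M MX" "Z \<in> measurable M MZ"
    using ind by (auto simp: indep_rv_iff)
  have "prob {\<omega>\<in>space M. f (X \<omega>) \<in> A \<and> g (Z \<omega>) \<in> B} =
      prob {\<omega>\<in>space M. f (X \<omega>) \<in> A} * prob {\<omega>\<in>space M. g (Z \<omega>) \<in> B}"
    if "A \<in> sets MV" "B \<in> sets MW" for A B
  proof -
    have "f -` A \<inter> space MX \<in> sets MX" "g -` B \<inter> space MZ \<in> sets MZ"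
      using f g that by (auto intro: measurable_sets)
    from ind[unfolded indep_rv_iff, THEN conjunct2, THEN conjunct2, THEN bspec, THEN bspec, OF this]
    have "prob {\<omega>\<in>space M. X \<omega> \<in> f -` A \<inter> space MX \<and> Z \<omega> \<in> g -` B \<inter> space MZ} =
       prob {\<omega>\<in>space M. X \<omega> \<in> f -` A \<inter> space MX} * prob {\<omega>\<in>space M. Z \<omega> \<in> g -` B \<inter> space MZ}" .
    moreover have "X \<omega> \<in> space MX" "Z \<omega> \<in> space MZ" if "\<omega> \<in> space M" for \<omega>
      using that by (auto intro: measurable_space[of _ M])
    ultimately show ?thesis by (simp cong: conj_cong)
  qed
  then show ?thesis using f g by (auto simp: indep_rv_iff)
qed

text \<open>Independence fixes the joint law on rectangles, and rectangles determine a product of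
  sigma-finite measures. Joint laws in this form can be compared one factor at a time.\<close>

lemma (in prob_space) indep_rv_distr_pair:
  assumes ind: "indep_rv M MX X MZ Z"
  shows "distr M (MX \<Otimes>\<^sub>M MZ) (\<lambda>\<omega>. (X \<omega>, Z \<omega>)) = distr M MX X \<Otimes>\<^sub>M distr M MZ Z"
proof -
  have [measurable]: "X \<in> measurable M MX" "Z \<in> measurable M MZ"
    using ind by (auto simp: indep_rv_iff)
  interpret X: prob_space "distr M MX X" by (rule prob_space_distr) simp
  interpret Z: prob_space "distr M MZ Z" by (rule prob_space_distr) simp
  show ?thesis
  proof (rule pair_measure_eqI[symmetric])
    fix A B assume AB: "A \<in> sets (distr M MX X)" "B \<in> sets (distr M MZ Z)"
    then have [measurable]: "A \<in> sets MX" "B \<in> sets MZ" by auto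
    have "emeasure M {\<omega>\<in>space M. X \<omega> \<in> A \<and> Z \<omega> \<in> B} =
        emeasure M {\<omega>\<in>space M. X \<omega> \<in> A} * emeasure M {\<omega>\<in>space M. Z \<omega> \<in> B}"
      using ind AB by (simp add: indep_rv_iff emeasure_eq_measure ennreal_mult)
    moreover have "(\<lambda>\<omega>. (X \<omega>, Z \<omega>)) -` (A \<times> B) \<inter> space M = {\<omega>\<in>space M. X \<omega> \<in> A \<and> Z \<omega> \<in> B}"
      "X -` A \<inter> space M = {\<omega>\<in>space M. X \<omega> \<in> A}" "Z -` B \<inter> space M = {\<omega>\<in>space M. Z \<omega> \<in> B}"
      by auto
    ultimately show "emeasure (distr M MX X) A * emeasure (distr M MZ Z) B =
        emeasure (distr M (MX \<Otimes>\<^sub>M MZ) (\<lambda>\<omega>. (X \<omega>, Z \<omega>))) (A \<times> B)"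
      by (simp add: emeasure_distr)
  qed (auto intro: X.sigma_finite_measure_axioms Z.sigma_finite_measure_axioms)
qed

text \<open>The conditioning event is an event of \<open>Z\<close>, so conditioning only shrinks the
  set of \<open>Z\<close>-values and rescales; the factor of \<open>X\<close> is untouched. With
  \<open>Z\<close> the pair of assignment and saturation level, conditioning on an exposure leaves
  the law of \<open>Y i\<close> unchanged.\<close>

lemma (in prob_space) indep_rv_uniform_measure:
  assumes ind: "indep_rv M MX X MZ Z" and E: "E \<in> sets MZ"
    and pos: "prob {\<omega>\<in>space M. Z \<omega> \<in> E} > 0"
  defines "N \<equiv> uniform_measure M {\<omega>\<in>space M. Z \<omega> \<in> E}"
  shows "indep_rv N MX X MZ Z" and "distr N MX X = distr M MX X"
proof -
  let ?E = "{\<omega>\<in>space M. Z \<omega> \<in> E}"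
  have [measurable]: "X \<in> measurable M MX" "Z \<in> measurable M MZ" "E \<in> sets MZ"
    using ind E by (auto simp: indep_rv_iff)
  have pos': "emeasure M ?E \<noteq> 0" "emeasure M ?E \<noteq> \<infinity>"
    using pos by (auto simp: emeasure_eq_measure)
  interpret N: prob_space N
    unfolding N_def using pos' by (rule prob_space_uniform_measure)
  have N: "N.prob {\<omega>\<in>space M. Q \<omega>} = prob {\<omega>\<in>space M. Q \<omega> \<and> Z \<omega> \<in> E} / prob ?E"
    if "{\<omega>\<in>space M. Q \<omega>} \<in> events" for Q
  proof -
    have "?E \<inter> {\<omega>\<in>space M. Q \<omega>} = {\<omega>\<in>space M. Q \<omega> \<and> Z \<omega> \<in> E}" by auto
    then show ?thesis
      unfolding N_def using measure_uniform_measure[OF pos' that] by simp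
  qed
  have rect: "prob {\<omega>\<in>space M. X \<omega> \<in> A \<and> Z \<omega> \<in> B} = prob {\<omega>\<in>space M. X \<omega> \<in> A} * prob {\<omega>\<in>space M. Z \<omega> \<in> B}"
    if "A \<in> sets MX" "B \<in> sets MZ" for A B
    using ind that by (auto simp: indep_rv_iff)
  have [simp]: "space N = space M" "measurable N K = measurable M K" for K :: "'x measure"
    by (auto simp: N_def intro: measurable_cong_sets)
  \<comment> \<open>The rectangle of \<open>A\<close> and \<open>E\<close> factors, and its second
    factor cancels against the normalizing constant.\<close>
  have X: "N.prob {\<omega>\<in>space M. X \<omega> \<in> A} = prob {\<omega>\<in>space M. X \<omega> \<in> A}" if [measurable]: "A \<in> sets MX" for A
    using rect[OF that E] pos by (subst N) auto
  have "N.prob {\<omega>\<in>space M. X \<omega> \<in> A \<and> Z \<omega> \<in> B} =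
      N.prob {\<omega>\<in>space M. X \<omega> \<in> A} * N.prob {\<omega>\<in>space M. Z \<omega> \<in> B}"
    if [measurable]: "A \<in> sets MX" "B \<in> sets MZ" for A B
    \<comment> \<open>Under \<open>N\<close>, the event that \<open>Z\<close> lies in
      \<open>B\<close> counts as the event that it lies in \<open>B \<inter> E\<close>, so
      \<open>rect\<close> is applied to that set.\<close>
    unfolding X[OF that(1)] using rect[of A "B \<inter> E"] by (subst (1 2) N) auto
  then show "indep_rv N MX X MZ Z"
    by (auto simp: N.indep_rv_iff)
  show "distr N MX X = distr M MX X"
  proof (rule measure_eqI)
    fix A assume "A \<in> sets (distr N MX X)"
    then have [measurable]: "A \<in> sets MX" by simp
    have "X -` A \<inter> space M = {\<omega>\<in>space M. X \<omega> \<in> A}" by auto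
    with X[of A] show "emeasure (distr N MX X) A = emeasure (distr M MX X) A"
      by (simp add: emeasure_distr N.emeasure_eq_measure emeasure_eq_measure)
  qed simp
qed

section \<open>Independence on a product space\<close>

text \<open>For each fixed \<open>u\<close>, \<open>f (Z, u)\<close> is a function of
  \<open>Z\<close> and hence independent of \<open>X\<close>; integrating over \<open>u\<close>
  pulls out the constant factor of \<open>X\<close>. Thus mixing \<open>Z\<close> with auxiliary
  randomness keeps it independent of \<open>X\<close>, as required for \<open>Y i\<close> and the
  redrawn treatments.\<close>

lemma (in pair_prob_space) indep_rv_fst_pair:
  assumes ind: "indep_rv M1 MX X MZ Z" and f: "f \<in> measurable (MZ \<Otimes>\<^sub>M M2) MW"
  shows "indep_rv (M1 \<Otimes>\<^sub>M M2) MX (\<lambda>\<omega>. X (fst \<omega>)) MW (\<lambda>\<omega>. f (Z (fst \<omega>), snd \<omega>))"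
proof -
  have [measurable]: "X \<in> measurable M1 MX" "Z \<in> measurable M1 MZ" "f \<in> measurable (MZ \<Otimes>\<^sub>M M2) MW"
    using ind f by (auto simp: M1.indep_rv_iff)
  have slice: "emeasure (M1 \<Otimes>\<^sub>M M2) {\<omega>\<in>space (M1 \<Otimes>\<^sub>M M2). R (fst \<omega>) (snd \<omega>)} =
      (\<integral>\<^sup>+u. emeasure M1 {\<omega>\<in>space M1. R \<omega> u} \<partial>M2)"
    if "{\<omega>\<in>space (M1 \<Otimes>\<^sub>M M2). R (fst \<omega>) (snd \<omega>)} \<in> sets (M1 \<Otimes>\<^sub>M M2)" for R
    unfolding emeasure_pair_measure_alt2[OF that]
    by (intro nn_integral_cong arg_cong[where f="emeasure M1"]) (auto simp: space_pair_measure)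
  have "prob {\<omega>\<in>space (M1 \<Otimes>\<^sub>M M2). X (fst \<omega>) \<in> A \<and> f (Z (fst \<omega>), snd \<omega>) \<in> B} =
      prob {\<omega>\<in>space (M1 \<Otimes>\<^sub>M M2). X (fst \<omega>) \<in> A} *
      prob {\<omega>\<in>space (M1 \<Otimes>\<^sub>M M2). f (Z (fst \<omega>), snd \<omega>) \<in> B}"
    if [measurable]: "A \<in> sets MX" "B \<in> sets MW" for A B
  proof -
    have rect: "emeasure M1 {\<omega>\<in>space M1. X \<omega> \<in> A \<and> f (Z \<omega>, u) \<in> B} =
        emeasure M1 {\<omega>\<in>space M1. X \<omega> \<in> A} * emeasure M1 {\<omega>\<in>space M1. f (Z \<omega>, u) \<in> B}"
      if "u \<in> space M2" for u
      using M1.indep_rv_compose[OF ind measurable_ident, of "\<lambda>z. f (z, u)" MW] that \<open>A \<in> sets MX\<close> \<open>B \<in> sets MW\<close>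
      by (simp add: M1.indep_rv_iff M1.emeasure_eq_measure ennreal_mult)
    have "emeasure (M1 \<Otimes>\<^sub>M M2) {\<omega>\<in>space (M1 \<Otimes>\<^sub>M M2). X (fst \<omega>) \<in> A \<and> f (Z (fst \<omega>), snd \<omega>) \<in> B} =
        (\<integral>\<^sup>+u. emeasure M1 {\<omega>\<in>space M1. X \<omega> \<in> A} * emeasure M1 {\<omega>\<in>space M1. f (Z \<omega>, u) \<in> B} \<partial>M2)"
      using slice[of "\<lambda>\<omega> u. X \<omega> \<in> A \<and> f (Z \<omega>, u) \<in> B"] by (simp add: rect cong: nn_integral_cong)
    also have "\<dots> = emeasure M1 {\<omega>\<in>space M1. X \<omega> \<in> A} * (\<integral>\<^sup>+u. emeasure M1 {\<omega>\<in>space M1. f (Z \<omega>, u) \<in> B} \<partial>M2)"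
      by (rule nn_integral_cmult) measurable
    also have "\<dots> = emeasure (M1 \<Otimes>\<^sub>M M2) {\<omega>\<in>space (M1 \<Otimes>\<^sub>M M2). X (fst \<omega>) \<in> A} *
        emeasure (M1 \<Otimes>\<^sub>M M2) {\<omega>\<in>space (M1 \<Otimes>\<^sub>M M2). f (Z (fst \<omega>), snd \<omega>) \<in> B}"
      using slice[of "\<lambda>\<omega> u. f (Z \<omega>, u) \<in> B"] slice[of "\<lambda>\<omega> u. X \<omega> \<in> A"] by (simp add: M2.emeasure_space_1)
    finally show ?thesis
      by (simp add: emeasure_eq_measure ennreal_mult[symmetric])
  qed
  then show ?thesis by (simp add: indep_rv_iff)
qed

text \<open>Events of separate coordinates intersect in a rectangle, whose product measure factors.
  The coupling will live on the second coordinate and the treatments outside the cluster on the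
  first.\<close>

lemma (in pair_prob_space) indep_rv_snd_fst:
  assumes [measurable]: "X \<in> measurable M2 MX" "Z \<in> measurable M1 MZ"
  shows "indep_rv (M1 \<Otimes>\<^sub>M M2) MX (\<lambda>\<omega>. X (snd \<omega>)) MZ (\<lambda>\<omega>. Z (fst \<omega>))"
proof -
  have "prob {\<omega>\<in>space (M1 \<Otimes>\<^sub>M M2). X (snd \<omega>) \<in> A \<and> Z (fst \<omega>) \<in> B} =
      prob {\<omega>\<in>space (M1 \<Otimes>\<^sub>M M2). X (snd \<omega>) \<in> A} * prob {\<omega>\<in>space (M1 \<Otimes>\<^sub>M M2). Z (fst \<omega>) \<in> B}"
    if [measurable]: "A \<in> sets MX" "B \<in> sets MZ" for A B
  proof -
    have "{\<omega>\<in>space (M1 \<Otimes>\<^sub>M M2). X (snd \<omega>) \<in> A \<and> Z (fst \<omega>) \<in> B} =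
        {x\<in>space M1. Z x \<in> B} \<times> {y\<in>space M2. X y \<in> A}"
      "{\<omega>\<in>space (M1 \<Otimes>\<^sub>M M2). X (snd \<omega>) \<in> A} = space M1 \<times> {y\<in>space M2. X y \<in> A}"
      "{\<omega>\<in>space (M1 \<Otimes>\<^sub>M M2). Z (fst \<omega>) \<in> B} = {x\<in>space M1. Z x \<in> B} \<times> space M2"
      by (auto simp: space_pair_measure)
    then show ?thesis
      by (simp add: measure_def M2.emeasure_pair_measure_Times enn2real_mult
          M1.emeasure_space_1 M2.emeasure_space_1)
  qed
  then show ?thesis by (simp add: indep_rv_iff)
qed

lemma (in pair_prob_space) distr_compose_snd:
  assumes [measurable]: "X \<in> measurable M2 N"
  shows "distr (M1 \<Otimes>\<^sub>M M2) N (\<lambda>\<omega>. X (snd \<omega>)) = distr M2 N X"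
proof (rule measure_eqI)
  fix A assume "A \<in> sets (distr (M1 \<Otimes>\<^sub>M M2) N (\<lambda>\<omega>. X (snd \<omega>)))"
  then have [measurable]: "A \<in> sets N" by simp
  have "(\<lambda>\<omega>. X (snd \<omega>)) -` A \<inter> space (M1 \<Otimes>\<^sub>M M2) = space M1 \<times> (X -` A \<inter> space M2)"
    by (auto simp: space_pair_measure)
  then show "emeasure (distr (M1 \<Otimes>\<^sub>M M2) N (\<lambda>\<omega>. X (snd \<omega>))) A = emeasure (distr M2 N X) A"
    by (simp add: emeasure_distr M2.emeasure_pair_measure_Times M1.emeasure_space_1)
qed simp

text \<open>On each of the countably many sets where the argument is constant, evaluation is a
  coordinate projection. It is applied to a random outcome map evaluated at a random
  assignment.\<close>

lemma measurable_apply_countable: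
  assumes "countable (UNIV :: 'i set)"
  shows "(\<lambda>(f, x). f x) \<in> measurable (PiM (UNIV :: 'i set) (\<lambda>_. N) \<Otimes>\<^sub>M count_space UNIV) N"
  unfolding split_beta
  by (rule measurable_compose_countable'[OF _ measurable_snd assms])
     (auto intro: measurable_compose[OF measurable_fst measurable_component_singleton])

section \<open>Uniform thresholds and the draw of a cluster\<close>

definition unif01 :: "real measure"
  where "unif01 = uniform_measure lborel {0..1}"

interpretation unif01: prob_space unif01
  unfolding unif01_def by (rule prob_space_uniform_measure) auto

interpretation unif01_product: product_prob_space "\<lambda>_. unif01" "UNIV :: 'n::finite set"
  by standard

lemma sets_unif01 [simp, measurable_cong]: "sets unif01 = sets borel"
  by (simp add: unif01_def)

lemma space_unif01 [simp]: "space unif01 = UNIV"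
  by (simp add: unif01_def)

text \<open>Inverse transform sampling: for \<open>q\<close> in the unit interval, the points up to
  \<open>q\<close> have length \<open>q\<close> and the remaining ones length
  \<open>1 - q\<close>.\<close>

lemma measure_unif01_threshold:
  assumes "0 \<le> q" "q \<le> 1"
  shows "measure unif01 {x. (x \<le> q) = b} = pmf (bernoulli_pmf q) b"
proof -
  have "{0..1} \<inter> {x. (x \<le> q) = b} = (if b then {0..q} else {q<..1})"
    using assms by auto
  moreover have "{x. (x \<le> q) = b} = (if b then {..q} else {q<..})"
    by auto
  ultimately show ?thesis
    using assms by (cases b) (simp_all add: unif01_def measure_uniform_measure)
qed

text \<open>Only the treatment component of the exposure is tested; the saturation component is a
  condition on the cluster level and appears separately.\<close>

definition exposure_compatible :: "bool option \<times> real \<Rightarrow> bool \<Rightarrow> bool"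
  where "exposure_compatible t b \<longleftrightarrow> (case fst t of None \<Rightarrow> True | Some d \<Rightarrow> b = d)"

text \<open>These are the units of the cluster whose treatment stays random once the exposure of
  \<open>i\<close> is fixed: a specified \<open>d\<close> pins unit \<open>i\<close>.\<close>

definition free_units :: "'n set \<Rightarrow> 'n \<Rightarrow> bool option \<times> real \<Rightarrow> 'n set"
  where "free_units A i t = (case fst t of None \<Rightarrow> A | Some d \<Rightarrow> A - {i})"

text \<open>Restricting to \<open>A\<close> gives the same extensional representation as in
  \<open>cluster_law\<close>, so the two laws are comparable on the whole function type.\<close>

definition cluster_draw ::
  "'n set \<Rightarrow> 'n \<Rightarrow> bool option \<times> real \<Rightarrow> ('n \<Rightarrow> real) \<Rightarrow> 'n \<Rightarrow> bool"
  where "cluster_draw A i t u =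
    restrict (\<lambda>j. case fst t of Some d \<Rightarrow> if j = i then d else u j \<le> snd t | None \<Rightarrow> u j \<le> snd t) A"

lemma measurable_finite_count_space:
  fixes f :: "'a \<Rightarrow> 'b::finite"
  assumes "\<And>b. {x\<in>space M. f x = b} \<in> sets M"
  shows "f \<in> measurable M (count_space UNIV)"
proof -
  have "f -` {b} \<inter> space M = {x\<in>space M. f x = b}" for b by auto
  then show ?thesis using assms by (simp add: measurable_count_space_eq2)
qed

text \<open>This separates the requirements on \<open>e\<close> alone from threshold conditions on
  distinct coordinates of \<open>u\<close>, from which measurability and the product formula both
  follow.\<close>

lemma cluster_draw_eq_iff:
  assumes "i \<in> A"
  shows "cluster_draw A i t u = e \<longleftrightarrow> e \<in> extensional A \<and> exposure_compatible t (e i) \<and>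
    (\<forall>j\<in>free_units A i t. (u j \<le> snd t) = e j)"
  using assms
  by (auto simp: cluster_draw_def exposure_compatible_def free_units_def fun_eq_iff
      extensional_def split: option.splits)

lemma measurable_cluster_draw [measurable]:
  fixes A :: "'n::finite set"
  assumes "i \<in> A"
  shows "cluster_draw A i t \<in> measurable (PiM UNIV (\<lambda>_. unif01)) (count_space UNIV)"
  by (rule measurable_finite_count_space) (simp add: cluster_draw_eq_iff[OF assms])

text \<open>The coordinates of \<open>u\<close> are independent, so the threshold conditions on the
  free units multiply. A vector that is not extensional or contradicts the pinned treatment is never
  drawn.\<close>

lemma prob_cluster_draw:
  fixes A :: "'n::finite set"
  assumes i: "i \<in> A" and t: "0 \<le> snd t" "snd t \<le> 1"
  shows "measure (PiM UNIV (\<lambda>_. unif01)) {u. cluster_draw A i t u = e} =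
    (if e \<in> extensional A \<and> exposure_compatible t (e i)
     then \<Prod>j\<in>free_units A i t. pmf (bernoulli_pmf (snd t)) (e j) else 0)"
proof (cases "e \<in> extensional A \<and> exposure_compatible t (e i)")
  case True
  have "{u. cluster_draw A i t u = e} = {u \<in> space (PiM UNIV (\<lambda>_. unif01)).
      \<forall>j\<in>free_units A i t. u j \<in> {x. (x \<le> snd t) = e j}}"
    using True by (simp add: cluster_draw_eq_iff[OF i] space_PiM)
  also have "measure (PiM UNIV (\<lambda>_. unif01)) \<dots> =
      (\<Prod>j\<in>free_units A i t. measure unif01 {x. (x \<le> snd t) = e j})"
    using unif01_product.emeasure_PiM_Collect[of "free_units A i t" "\<lambda>j. {x. (x \<le> snd t) = e j}"]
    by (simp add: unif01_product.emeasure_eq_measure unif01.emeasure_eq_measure prod_ennreal prod_nonneg)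
  finally show ?thesis
    using True t by (simp add: measure_unif01_threshold)
next
  case False
  then have "{u. cluster_draw A i t u = e} = {}"
    by (auto simp: cluster_draw_eq_iff[OF i])
  with False show ?thesis
    by (simp only: if_False measure_empty)
qed

text \<open>This rectangle form exhibits the exposure as an event of the pair from which
  \<open>Y i\<close> is assumed independent, ready for
  \<open>indep_rv_uniform_measure\<close>.\<close>

lemma Collect_exposure_event:
  "exposure_event M m C St D i t = {\<omega>\<in>space M.
     (D \<omega>, unit_saturation m C St i \<omega>) \<in> {d. exposure_compatible t (d i)} \<times> {snd t}}"
  by (auto simp: exposure_event_def exposure_compatible_def)

section \<open>Clusters and measurability in the design\<close>

context randomized_saturation_design
begin

abbreviation own :: "'n \<Rightarrow> 'n set"
  where "own \<equiv> own_cluster m C"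

abbreviation S :: "'n \<Rightarrow> 'a \<Rightarrow> real"
  where "S \<equiv> unit_saturation m C St"

abbreviation T_event :: "'n \<Rightarrow> bool option \<times> real \<Rightarrow> 'a set"
  where "T_event \<equiv> exposure_event M m C St D"

abbreviation given_T :: "'n \<Rightarrow> bool option \<times> real \<Rightarrow> 'a measure"
  where "given_T \<equiv> given_exposure M m C St D"

text \<open>Existence is the covering property. For uniqueness, injectivity of \<open>C\<close>
  turns distinct indices into distinct classes, which are disjoint. This makes the definite
  description in \<open>cluster_index\<close> meaningful.\<close>

lemma cluster_index_unique:
  "\<exists>!j. j \<in> {1..m} \<and> i \<in> C j"
proof -
  obtain j where j: "j \<in> {1..m}" "i \<in> C j"
    using partition_onD1[OF clusters(1)] by blast
  have "k = j" if k: "k \<in> {1..m}" "i \<in> C k" for k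
  proof (rule ccontr)
    assume "k \<noteq> j"
    then have "C k \<noteq> C j"
      using j k inj_onD[OF clusters(2)] by auto
    then have "C k \<inter> C j = {}"
      using j k by (intro disjointD[OF partition_onD2[OF clusters(1)]]) auto
    with j k show False by auto
  qed
  with j show ?thesis by auto
qed

lemma cluster_index_in: "cluster_index m C i \<in> {1..m}"
  and own_cluster_self: "i \<in> own i"
  unfolding own_cluster_def cluster_index_def
  using theI'[OF cluster_index_unique[of i]] by auto

lemma cluster_index_eq: "j \<in> {1..m} \<Longrightarrow> i \<in> C j \<Longrightarrow> cluster_index m C i = j"
  unfolding cluster_index_def using cluster_index_unique[of i] by (intro the1_equality) auto

lemma Union_other_clusters: "(\<Union>j\<in>{1..m} - {cluster_index m C i}. C j) = - own i"
proof safe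
  fix j k assume jk: "j \<in> {1..m}" "k \<in> C j" "k \<in> own i" "j \<notin> {}" "j \<noteq> cluster_index m C i"
  then show False
    using cluster_index_eq[OF jk(1,2)] cluster_index_eq[OF cluster_index_in[of i], of k]
    by (simp add: own_cluster_def)
next
  fix k assume "k \<notin> own i"
  then show "k \<in> (\<Union>j\<in>{1..m} - {cluster_index m C i}. C j)"
    using cluster_index_in[of k] own_cluster_self[of k]
    by (intro UN_I[of "cluster_index m C k"]) (auto simp: own_cluster_def)
qed

lemma measurable_design [measurable]:
  "Y i \<in> measurable M (PiM UNIV (\<lambda>_. borel))"
  "D \<in> measurable M (count_space UNIV)"
  "S i \<in> borel_measurable M"
proof -
  \<comment> \<open>Independence of \<open>Y i\<close> from the design includes measurability of the
    pair, hence of its components.\<close>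
  have *: "(\<lambda>\<omega>. (D \<omega>, S i \<omega>)) \<in> measurable M (count_space UNIV \<Otimes>\<^sub>M borel)" for i
    using outcomes_indep[of i] by (auto simp: indep_rv_def)
  show "D \<in> measurable M (count_space UNIV)" "S i \<in> borel_measurable M"
    using measurable_compose[OF * measurable_fst] measurable_compose[OF * measurable_snd] by simp_all
  show "Y i \<in> measurable M (PiM UNIV (\<lambda>_. borel))"
    using outcomes_indep[of i] by (auto simp: indep_rv_def)
qed

lemma measurable_treatments [measurable]: "(\<lambda>\<omega>. h (D \<omega>)) \<in> measurable M (count_space UNIV)"
  by (rule measurable_compose[OF measurable_design(2) measurable_count_space])

lemma T_event_in_events [measurable]: "T_event i t \<in> events"
  unfolding exposure_event_def exposure_compatible_def[symmetric] by measurable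

section \<open>Treatment probabilities under the design\<close>

text \<open>Given the level, the cluster treatments are independent Bernoulli; multiplying by the
  probability of the level removes the conditioning. The set \<open>J\<close> is arbitrary because
  the formula is used both for the whole cluster and for its pinned units.\<close>

lemma prob_level_treatments:
  assumes q: "q \<in> P" and pos: "prob {\<omega>\<in>space M. S i \<omega> = q} > 0" and J: "J \<subseteq> own i"
  shows "prob {\<omega>\<in>space M. S i \<omega> = q \<and> (\<forall>k\<in>J. D \<omega> k = e k)} =
    prob {\<omega>\<in>space M. S i \<omega> = q} * (\<Prod>k\<in>J. pmf (bernoulli_pmf q) (e k))"
\<comment> \<open>The independence rule \<open>indep_varsD\<close> asks for a nonempty index set;
  for empty \<open>J\<close> the product is 1.\<close>
proof (cases "J = {}")
  case False
  let ?j = "cluster_index m C i"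
  let ?E = "{\<omega>\<in>space M. S i \<omega> = q}"
  have E: "?E = {\<omega>\<in>space M. St ?j \<omega> = q}"
    by (simp add: unit_saturation_def)
  define N where "N = uniform_measure M ?E"
  have pos': "emeasure M ?E \<noteq> 0" "emeasure M ?E \<noteq> \<infinity>"
    using pos by (auto simp: emeasure_eq_measure)
  interpret N: prob_space N
    unfolding N_def using pos' by (rule prob_space_uniform_measure)
  have [simp]: "space N = space M" by (simp add: N_def)
  have "N.indep_vars (\<lambda>_. count_space UNIV) (\<lambda>k \<omega>. D \<omega> k) (own i)"
    using treatments_indep[OF cluster_index_in q, of i] pos by (simp add: N_def E own_cluster_def)
  from N.indep_varsD[OF this False _ J, of "\<lambda>k. {e k}"]
  have "N.prob (\<Inter>k\<in>J. (\<lambda>\<omega>. D \<omega> k) -` {e k} \<inter> space M) =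
      (\<Prod>k\<in>J. N.prob ((\<lambda>\<omega>. D \<omega> k) -` {e k} \<inter> space M))"
    by simp
  also have "(\<Inter>k\<in>J. (\<lambda>\<omega>. D \<omega> k) -` {e k} \<inter> space M) = {\<omega>\<in>space M. \<forall>k\<in>J. D \<omega> k = e k}"
    using False by auto
  also have "(\<Prod>k\<in>J. N.prob ((\<lambda>\<omega>. D \<omega> k) -` {e k} \<inter> space M)) = (\<Prod>k\<in>J. pmf (bernoulli_pmf q) (e k))"
  proof (rule prod.cong)
    fix k assume "k \<in> J"
    then have "k \<in> C ?j" using J by (auto simp: own_cluster_def)
    then have "distr N (count_space UNIV) (\<lambda>\<omega>. D \<omega> k) = measure_pmf (bernoulli_pmf q)"
      using treatments_bernoulli[OF cluster_index_in q, of i k] pos by (simp add: N_def E)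
    moreover have "(\<lambda>\<omega>. D \<omega> k) \<in> measurable N (count_space UNIV)"
      by (simp add: N_def)
    ultimately show "N.prob ((\<lambda>\<omega>. D \<omega> k) -` {e k} \<inter> space M) = pmf (bernoulli_pmf q) (e k)"
      using measure_distr[of "\<lambda>\<omega>. D \<omega> k" N "count_space UNIV" "{e k}"] by (simp add: measure_pmf_single)
  qed simp
  also have "N.prob {\<omega>\<in>space M. \<forall>k\<in>J. D \<omega> k = e k} =
      prob (?E \<inter> {\<omega>\<in>space M. \<forall>k\<in>J. D \<omega> k = e k}) / prob ?E"
    unfolding N_def by (rule measure_uniform_measure[OF pos']) measurable
  also have "?E \<inter> {\<omega>\<in>space M. \<forall>k\<in>J. D \<omega> k = e k} = {\<omega>\<in>space M. S i \<omega> = q \<and> (\<forall>k\<in>J. D \<omega> k = e k)}"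
    by auto
  finally show ?thesis using pos by (simp add: field_simps)
qed simp

lemma measure_given_T:
  assumes pos: "prob (T_event i t) > 0"
  shows "prob_space (given_T i t)" and
    "{\<omega>\<in>space M. Q \<omega>} \<in> events \<Longrightarrow> measure (given_T i t) {\<omega>\<in>space M. Q \<omega>} =
      prob {\<omega>\<in>space M. \<omega> \<in> T_event i t \<and> Q \<omega>} / prob (T_event i t)"
proof -
  have pos': "emeasure M (T_event i t) \<noteq> 0" "emeasure M (T_event i t) \<noteq> \<infinity>"
    using pos by (auto simp: emeasure_eq_measure)
  show "prob_space (given_T i t)"
    unfolding given_exposure_def using pos' by (rule prob_space_uniform_measure)
  assume Q: "{\<omega>\<in>space M. Q \<omega>} \<in> events"
  have "T_event i t \<inter> {\<omega>\<in>space M. Q \<omega>} = {\<omega>\<in>space M. \<omega> \<in> T_event i t \<and> Q \<omega>}" by auto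
  then show "measure (given_T i t) {\<omega>\<in>space M. Q \<omega>} =
      prob {\<omega>\<in>space M. \<omega> \<in> T_event i t \<and> Q \<omega>} / prob (T_event i t)"
    unfolding given_exposure_def using measure_uniform_measure[OF pos' Q] by simp
qed

lemma given_T_simps [simp]:
  "space (given_T i t) = space M" "measurable (given_T i t) K = measurable M K"
  by (auto simp: given_exposure_def intro: measurable_cong_sets)

text \<open>This is the formula of \<open>prob_cluster_draw\<close>: conditioning on the exposure
  divides the Bernoulli product over the cluster by the factor of the pinned unit, if there is one,
  and leaves the product over the free units.\<close>

lemma prob_cluster_given_T:
  assumes q: "snd t \<in> P" and pos: "prob (T_event i t) > 0"
  shows "measure (given_T i t) {\<omega>\<in>space M. restrict (D \<omega>) (own i) = e} =
    (if e \<in> extensional (own i) \<and> exposure_compatible t (e i)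
     then \<Prod>j\<in>free_units (own i) i t. pmf (bernoulli_pmf (snd t)) (e j) else 0)"
proof (cases "e \<in> extensional (own i) \<and> exposure_compatible t (e i)")
  case True
  let ?F = "free_units (own i) i t" and ?b = "\<lambda>j. pmf (bernoulli_pmf (snd t)) (e j)"
  let ?p = "prob {\<omega>\<in>space M. S i \<omega> = snd t}"
  have F: "?F \<subseteq> own i"
    by (auto simp: free_units_def split: option.splits)
  \<comment> \<open>The exposure implies the saturation level, so overlap makes the level have
    positive probability too.\<close>
  have "prob (T_event i t) \<le> ?p"
    by (rule finite_measure_mono) (auto simp: exposure_event_def)
  with pos have p: "?p > 0" by linarith
  \<comment> \<open>The pinned units form \<open>{i}\<close> or the empty set, and \<open>e\<close>
    agrees with the exposure there. So the exposure event is itself of the form treated by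
    \<open>prob_level_treatments\<close>.\<close>
  have T: "T_event i t = {\<omega>\<in>space M. S i \<omega> = snd t \<and> (\<forall>k\<in>own i - ?F. D \<omega> k = e k)}"
    using True own_cluster_self[of i]
    by (auto simp: exposure_event_def exposure_compatible_def free_units_def split: option.splits)
  have "restrict (D \<omega>) (own i) = e \<longleftrightarrow> (\<forall>k\<in>own i. D \<omega> k = e k)" for \<omega>
    using True by (auto simp: fun_eq_iff extensional_def)
  then have "{\<omega>\<in>space M. \<omega> \<in> T_event i t \<and> restrict (D \<omega>) (own i) = e} =
      {\<omega>\<in>space M. S i \<omega> = snd t \<and> (\<forall>k\<in>own i. D \<omega> k = e k)}"
    unfolding T by auto
  then have "measure (given_T i t) {\<omega>\<in>space M. restrict (D \<omega>) (own i) = e} =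
      (?p * (\<Prod>k\<in>own i. ?b k)) / prob (T_event i t)"
    by (subst measure_given_T[OF pos]) (simp_all add: prob_level_treatments[OF q p])
  also have "(\<Prod>k\<in>own i. ?b k) = (\<Prod>k\<in>own i - ?F. ?b k) * (\<Prod>k\<in>?F. ?b k)"
    using F by (intro prod.subset_diff) auto
  also have "?p * ((\<Prod>k\<in>own i - ?F. ?b k) * (\<Prod>k\<in>?F. ?b k)) = prob (T_event i t) * (\<Prod>k\<in>?F. ?b k)"
    unfolding T by (simp add: prob_level_treatments[OF q p])
  finally show ?thesis
    unfolding if_P[OF True] nonzero_mult_div_cancel_left[OF less_imp_neq[OF pos, symmetric]] .
next
  case False
  then have "{\<omega>\<in>space M. \<omega> \<in> T_event i t \<and> restrict (D \<omega>) (own i) = e} = {}"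
    using own_cluster_self[of i]
    by (auto simp: exposure_event_def exposure_compatible_def split: option.splits)
  then have "prob {\<omega>\<in>space M. \<omega> \<in> T_event i t \<and> restrict (D \<omega>) (own i) = e} = 0"
    by (simp only: measure_empty)
  then have "measure (given_T i t) {\<omega>\<in>space M. restrict (D \<omega>) (own i) = e} = 0"
    by (subst measure_given_T[OF pos]) simp_all
  with False show ?thesis by (simp only: if_False)
qed

text \<open>Independence across clusters factors an event with one condition per cluster. The set
  \<open>E\<close> may involve the saturation level as well as the treatments, because exposures
  do.\<close>

lemma own_cluster_indep_others:
  assumes E: "E \<in> sets (borel \<Otimes>\<^sub>M count_space UNIV)"
  shows "prob {\<omega>\<in>space M. (S i \<omega>, restrict (D \<omega>) (own i)) \<in> E \<and> restrict (D \<omega>) (- own i) = restrict d (- own i)} =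
    prob {\<omega>\<in>space M. (S i \<omega>, restrict (D \<omega>) (own i)) \<in> E} *
    prob {\<omega>\<in>space M. restrict (D \<omega>) (- own i) = restrict d (- own i)}"
proof -
  let ?j = "cluster_index m C i"
  let ?X = "\<lambda>j \<omega>. (St j \<omega>, restrict (D \<omega>) (C j))"
  let ?others = "\<Prod>j\<in>{1..m} - {?j}. prob {\<omega>\<in>space M. restrict (D \<omega>) (C j) = restrict d (C j)}"
  have factor: "prob {\<omega>\<in>space M. (S i \<omega>, restrict (D \<omega>) (own i)) \<in> E \<and> restrict (D \<omega>) (- own i) = restrict d (- own i)} =
      prob {\<omega>\<in>space M. (S i \<omega>, restrict (D \<omega>) (own i)) \<in> E} * ?others"
    if E: "E \<in> sets (borel \<Otimes>\<^sub>M count_space UNIV)" for E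
  proof -
    \<comment> \<open>The own cluster carries the condition \<open>E\<close>; every other cluster
      has its treatments fixed to those of \<open>d\<close> and its level left unrestricted.\<close>
    define R where "R j = (if j = ?j then E else UNIV \<times> {restrict d (C j)})" for j
    have R: "R j \<in> sets (borel \<Otimes>\<^sub>M count_space UNIV)" for j
      using E by (auto simp: R_def)
    have "restrict (D \<omega>) (- own i) = restrict d (- own i) \<longleftrightarrow>
        (\<forall>j\<in>{1..m} - {?j}. restrict (D \<omega>) (C j) = restrict d (C j))" for \<omega>
      unfolding Union_other_clusters[symmetric] by (auto simp: fun_eq_iff restrict_def)
    then have "{\<omega>\<in>space M. (S i \<omega>, restrict (D \<omega>) (own i)) \<in> E \<and> restrict (D \<omega>) (- own i) = restrict d (- own i)} =
        (\<Inter>j\<in>{1..m}. ?X j -` R j \<inter> space M)"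
      using cluster_index_in[of i]
      by (auto simp: R_def unit_saturation_def own_cluster_def split: if_splits)
    also have "prob \<dots> = (\<Prod>j\<in>{1..m}. prob (?X j -` R j \<inter> space M))"
      using cluster_index_in[of i] R by (intro indep_varsD[OF clusters_indep]) auto
    also have "\<dots> = prob (?X ?j -` R ?j \<inter> space M) * (\<Prod>j\<in>{1..m} - {?j}. prob (?X j -` R j \<inter> space M))"
      using cluster_index_in[of i] by (intro prod.remove) auto
    also have "?X ?j -` R ?j \<inter> space M = {\<omega>\<in>space M. (S i \<omega>, restrict (D \<omega>) (own i)) \<in> E}"
      by (auto simp: R_def unit_saturation_def own_cluster_def)
    also have "(\<Prod>j\<in>{1..m} - {?j}. prob (?X j -` R j \<inter> space M)) = ?others"
      by (intro prod.cong refl arg_cong[where f=prob]) (auto simp: R_def)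
    finally show ?thesis .
  qed
  \<comment> \<open>Taking the full space for \<open>E\<close> identifies the product over the other
    clusters as the probability of the outside assignment.\<close>
  have "prob {\<omega>\<in>space M. restrict (D \<omega>) (- own i) = restrict d (- own i)} = ?others"
    using factor[OF sets.top] by (simp add: prob_space space_pair_measure)
  with factor[OF E] show ?thesis by simp
qed

section \<open>Redrawing the cluster of a unit on the enlarged space\<close>

abbreviation U :: "('n \<Rightarrow> real) measure"
  where "U \<equiv> PiM UNIV (\<lambda>_. unif01)"

abbreviation draw :: "'n \<Rightarrow> bool option \<times> real \<Rightarrow> ('n \<Rightarrow> real) \<Rightarrow> 'n \<Rightarrow> bool"
  where "draw i \<equiv> cluster_draw (own i) i"

text \<open>The argument is a pair of assignment and thresholds so that \<open>redraw\<close> can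
  serve as the map \<open>f\<close> of \<open>indep_rv_fst_pair\<close>.\<close>

definition redraw :: "'n \<Rightarrow> bool option \<times> real \<Rightarrow> ('n \<Rightarrow> bool) \<times> ('n \<Rightarrow> real) \<Rightarrow> 'n \<Rightarrow> bool"
  where "redraw i t = (\<lambda>(d, u). merge (own i) (- own i) (draw i t u, d))"

sublocale enlarged: pair_prob_space M U ..

lemma measurable_draw [measurable]: "draw i t \<in> measurable U (count_space UNIV)"
  by (rule measurable_cluster_draw[OF own_cluster_self])

lemma measurable_redraw [measurable]:
  "redraw i t \<in> measurable (count_space UNIV \<Otimes>\<^sub>M U) (count_space UNIV)"
proof (rule measurable_finite_count_space)
  fix d
  have "redraw i t x = d \<longleftrightarrow> fst x \<in> {d'. restrict d' (- own i) = restrict d (- own i)} \<and>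
      draw i t (snd x) = restrict d (own i)" for x
  proof -
    have "draw i t u \<in> extensional (own i)" for u
      by (simp add: cluster_draw_def)
    then show ?thesis
      by (cases x) (auto simp: redraw_def merge_def fun_eq_iff restrict_def extensional_def)
  qed
  then show "{x \<in> space (count_space UNIV \<Otimes>\<^sub>M U). redraw i t x = d} \<in> sets (count_space UNIV \<Otimes>\<^sub>M U)"
    by simp
qed

text \<open>Both laws live on a finite space, and their point masses are given by the same product
  over the free units.\<close>

lemma distr_draw:
  assumes q: "snd t \<in> P" and pos: "prob (T_event i t) > 0"
  shows "distr U (count_space UNIV) (draw i t) = cluster_law M m C St D i t"
proof (rule measure_eqI_countable)
  interpret G: prob_space "given_T i t"
    using pos by (rule measure_given_T)
  fix e :: "'n \<Rightarrow> bool"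
  have "0 \<le> snd t" "snd t \<le> 1" using q levels by auto
  from prob_cluster_draw[OF own_cluster_self this, of i e]
  have "measure U {u. draw i t u = e} = G.prob {\<omega>\<in>space M. restrict (D \<omega>) (own i) = e}"
    by (simp only: prob_cluster_given_T[OF assms])
  moreover have "draw i t -` {e} \<inter> space U = {u. draw i t u = e}"
    "(\<lambda>\<omega>. restrict (D \<omega>) (own i)) -` {e} \<inter> space M = {\<omega>\<in>space M. restrict (D \<omega>) (own i) = e}"
    by (auto simp: space_PiM)
  ultimately show "emeasure (distr U (count_space UNIV) (draw i t)) {e} =
      emeasure (cluster_law M m C St D i t) {e}"
    unfolding cluster_law_def
    by (simp add: emeasure_distr G.emeasure_eq_measure unif01_product.emeasure_eq_measure)
qed (auto simp: cluster_law_def)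

text \<open>Point masses are compared. Each splits into a part inside the cluster and a part
  outside: the inside parts agree by \<open>distr_draw\<close>, and the outside part keeps its
  unconditional law because the exposure concerns only the own cluster.\<close>

lemma distr_redraw:
  assumes q: "snd t \<in> P" and pos: "prob (T_event i t) > 0"
  shows "distr (M \<Otimes>\<^sub>M U) (count_space UNIV) (\<lambda>\<omega>. redraw i t (D (fst \<omega>), snd \<omega>)) =
    distr (given_T i t) (count_space UNIV) D"
proof (rule measure_eqI_countable)
  interpret G: prob_space "given_T i t"
    using pos by (rule measure_given_T)
  fix d :: "'n \<Rightarrow> bool"
  let ?in = "\<lambda>\<omega>. restrict (D \<omega>) (own i) = restrict d (own i)"
  let ?out = "\<lambda>\<omega>. restrict (D \<omega>) (- own i) = restrict d (- own i)"
  have split: "D \<omega> = d \<longleftrightarrow> ?in \<omega> \<and> ?out \<omega>" for \<omega>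
    by (auto simp: fun_eq_iff restrict_def)
  \<comment> \<open>The preimage is a rectangle: the outside treatments are read from
    \<open>M\<close>, the inside ones from \<open>U\<close>.\<close>
  have "(\<lambda>\<omega>. redraw i t (D (fst \<omega>), snd \<omega>)) -` {d} \<inter> space (M \<Otimes>\<^sub>M U) =
      {\<omega>\<in>space M. ?out \<omega>} \<times> {u\<in>space U. draw i t u = restrict d (own i)}"
  proof -
    have "draw i t u \<in> extensional (own i)" for u
      by (simp add: cluster_draw_def)
    then show ?thesis
      by (auto simp: redraw_def merge_def fun_eq_iff restrict_def extensional_def space_pair_measure)
  qed
  then have "emeasure (distr (M \<Otimes>\<^sub>M U) (count_space UNIV) (\<lambda>\<omega>. redraw i t (D (fst \<omega>), snd \<omega>))) {d} =
      emeasure M {\<omega>\<in>space M. ?out \<omega>} * emeasure U {u\<in>space U. draw i t u = restrict d (own i)}"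
    by (simp add: emeasure_distr unif01_product.emeasure_pair_measure_Times)
  also have "{u\<in>space U. draw i t u = restrict d (own i)} = draw i t -` {restrict d (own i)} \<inter> space U"
    by auto
  also have "emeasure U \<dots> = emeasure (cluster_law M m C St D i t) {restrict d (own i)}"
    unfolding distr_draw[OF assms, symmetric] by (simp add: emeasure_distr)
  also have "\<dots> = G.prob {\<omega>\<in>space M. ?in \<omega>}"
    unfolding cluster_law_def
    by (simp add: emeasure_distr G.emeasure_eq_measure vimage_def Int_def conj_commute)
  also have "emeasure M {\<omega>\<in>space M. ?out \<omega>} * G.prob {\<omega>\<in>space M. ?in \<omega>} = G.prob {\<omega>\<in>space M. D \<omega> = d}"
  proof -
    \<comment> \<open>Since \<open>i\<close> lies in its own cluster, its treatment can be read off
      the restricted vector; hence exposure and inside treatments together form an event of the own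
      cluster.\<close>
    let ?E = "{snd t} \<times> {e. e = restrict d (own i) \<and> exposure_compatible t (e i)}"
    have E: "?E \<in> sets (borel \<Otimes>\<^sub>M count_space UNIV)"
      by (intro pair_measureI) auto
    have "\<omega> \<in> T_event i t \<and> ?in \<omega> \<longleftrightarrow> (S i \<omega>, restrict (D \<omega>) (own i)) \<in> ?E" if "\<omega> \<in> space M" for \<omega>
      using that own_cluster_self[of i]
      by (auto simp: exposure_event_def exposure_compatible_def split: option.splits)
    then have "{\<omega>\<in>space M. (S i \<omega>, restrict (D \<omega>) (own i)) \<in> ?E \<and> ?out \<omega>} =
        {\<omega>\<in>space M. \<omega> \<in> T_event i t \<and> D \<omega> = d}"
      "{\<omega>\<in>space M. (S i \<omega>, restrict (D \<omega>) (own i)) \<in> ?E} = {\<omega>\<in>space M. \<omega> \<in> T_event i t \<and> ?in \<omega>}"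
      unfolding split by blast+
    with own_cluster_indep_others[OF E, of i d]
    have "prob {\<omega>\<in>space M. \<omega> \<in> T_event i t \<and> D \<omega> = d} =
        prob {\<omega>\<in>space M. \<omega> \<in> T_event i t \<and> ?in \<omega>} * prob {\<omega>\<in>space M. ?out \<omega>}"
      by simp
    then show ?thesis
      by (simp add: measure_given_T(2)[OF pos] emeasure_eq_measure ennreal_mult'[symmetric] mult.commute)
  qed
  also have "\<dots> = emeasure (distr (given_T i t) (count_space UNIV) D) {d}"
    by (simp add: emeasure_distr G.emeasure_eq_measure vimage_def Int_def conj_commute)
  finally show "emeasure (distr (M \<Otimes>\<^sub>M U) (count_space UNIV) (\<lambda>\<omega>. redraw i t (D (fst \<omega>), snd \<omega>))) {d} =
      emeasure (distr (given_T i t) (count_space UNIV) D) {d}" .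
qed auto

text \<open>Both sides are the product of the law of \<open>Y i\<close> and a treatment law. Under
  conditioning this holds because the exposure is an event of the design; on the enlarged space,
  because \<open>redraw\<close> uses only \<open>D\<close> and the thresholds. The treatment laws
  agree by \<open>distr_redraw\<close>.\<close>

lemma joint_law_redraw:
  assumes q: "snd t \<in> P" and pos: "prob (T_event i t) > 0"
  shows "distr (M \<Otimes>\<^sub>M U) (PiM UNIV (\<lambda>_. borel) \<Otimes>\<^sub>M count_space UNIV)
      (\<lambda>\<omega>. (Y i (fst \<omega>), redraw i t (D (fst \<omega>), snd \<omega>))) =
    distr (given_T i t) (PiM UNIV (\<lambda>_. borel) \<Otimes>\<^sub>M count_space UNIV) (\<lambda>\<omega>. (Y i \<omega>, D \<omega>))"
proof -
  interpret G: prob_space "given_T i t"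
    using pos by (rule measure_given_T)
  let ?E = "{d. exposure_compatible t (d i)} \<times> {snd t}"
  have "?E \<in> sets (count_space UNIV \<Otimes>\<^sub>M borel)" by auto
  note G = indep_rv_uniform_measure[OF outcomes_indep[of i] this,
      folded Collect_exposure_event[of M m C St D i t],
      folded given_exposure_def, OF pos]
  have "distr (given_T i t) (PiM UNIV (\<lambda>_. borel) \<Otimes>\<^sub>M count_space UNIV) (\<lambda>\<omega>. (Y i \<omega>, D \<omega>)) =
      distr M (PiM UNIV (\<lambda>_. borel)) (Y i) \<Otimes>\<^sub>M distr (given_T i t) (count_space UNIV) D"
    using G.indep_rv_distr_pair[OF G.indep_rv_compose[OF G(1) measurable_ident measurable_fst]]
    by (simp add: G(2))
  moreover have "indep_rv M (PiM UNIV (\<lambda>_. borel)) (Y i) (count_space UNIV) D"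
    using indep_rv_compose[OF outcomes_indep measurable_ident measurable_fst] by simp
  note enlarged.indep_rv_distr_pair[OF enlarged.indep_rv_fst_pair[OF this measurable_redraw[of i t]]]
  moreover have "distr (M \<Otimes>\<^sub>M U) (PiM UNIV (\<lambda>_. borel)) (\<lambda>\<omega>. Y i (fst \<omega>)) =
      distr M (PiM UNIV (\<lambda>_. borel)) (Y i)"
    using distr_distr[of "Y i" M "PiM UNIV (\<lambda>_. borel)" fst "M \<Otimes>\<^sub>M U"]
    by (simp add: unif01_product.distr_pair_fst comp_def)
  ultimately show ?thesis
    by (simp add: distr_redraw[OF assms])
qed

text \<open>Mean and integrability of an outcome depend only on the joint law of outcome map and
  assignment, through the evaluation map.\<close>

lemma mean_redraw:
  assumes q: "snd t \<in> P" and pos: "prob (T_event i t) > 0"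
  shows "(\<integral>\<omega>. Y i (fst \<omega>) (redraw i t (D (fst \<omega>), snd \<omega>)) \<partial>(M \<Otimes>\<^sub>M U)) =
      (\<integral>\<omega>. Y i \<omega> (D \<omega>) \<partial>given_T i t)"
    and "integrable (M \<Otimes>\<^sub>M U) (\<lambda>\<omega>. Y i (fst \<omega>) (redraw i t (D (fst \<omega>), snd \<omega>))) \<longleftrightarrow>
      integrable (given_T i t) (\<lambda>\<omega>. Y i \<omega> (D \<omega>))"
proof -
  let ?N = "PiM UNIV (\<lambda>_. borel) \<Otimes>\<^sub>M count_space UNIV :: ((('n \<Rightarrow> bool) \<Rightarrow> real) \<times> ('n \<Rightarrow> bool)) measure"
  have [measurable]: "(\<lambda>(y, d). y d) \<in> borel_measurable ?N"
    by (rule measurable_apply_countable) simp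
  have [measurable]: "(\<lambda>\<omega>. (Y i (fst \<omega>), redraw i t (D (fst \<omega>), snd \<omega>))) \<in> measurable (M \<Otimes>\<^sub>M U) ?N"
    "(\<lambda>\<omega>. (Y i \<omega>, D \<omega>)) \<in> measurable (given_T i t) ?N"
    by simp_all
  note law = joint_law_redraw[OF assms, THEN arg_cong]
  show "(\<integral>\<omega>. Y i (fst \<omega>) (redraw i t (D (fst \<omega>), snd \<omega>)) \<partial>(M \<Otimes>\<^sub>M U)) = (\<integral>\<omega>. Y i \<omega> (D \<omega>) \<partial>given_T i t)"
    using law[of "\<lambda>N. integral\<^sup>L N (\<lambda>(y, d). y d)"] by (simp add: integral_distr)
  show "integrable (M \<Otimes>\<^sub>M U) (\<lambda>\<omega>. Y i (fst \<omega>) (redraw i t (D (fst \<omega>), snd \<omega>))) \<longleftrightarrow>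
      integrable (given_T i t) (\<lambda>\<omega>. Y i \<omega> (D \<omega>))"
    using law[of "\<lambda>N. integrable N (\<lambda>(y, d). y d)"] by (simp add: integrable_distr_eq)
qed

end

section \<open>The monotone coupling and the exposure contrast\<close>

theorem theorem2:
  fixes M :: "'a measure"
    and C :: "nat \<Rightarrow> ('n::finite) set"
    and D :: "'a \<Rightarrow> 'n \<Rightarrow> bool"
    and Y :: "'n \<Rightarrow> 'a \<Rightarrow> ('n \<Rightarrow> bool) \<Rightarrow> real"
    and t t' :: "bool option \<times> real"
  assumes design: "randomized_saturation_design M m C St P D Y"
    and levels: "p \<in> P" "p' \<in> P" "p \<ge> p'"
    and contrast:
      "(\<exists>d. t = (Some d, p) \<and> t' = (Some d, p')) \<or>
       (t = (Some True, p) \<and> t' = (Some False, p')) \<or>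
       (t = (None, p) \<and> t' = (None, p'))"
    and overlap: "\<forall>i. \<forall>s\<in>{t, t'}. measure M (exposure_event M m C St D i s) > 0"
    and means_exist:
      "\<forall>i. \<forall>s\<in>{t, t'}. integrable (given_exposure M m C St D i s) (\<lambda>\<omega>. Y i \<omega> (D \<omega>))"
  shows "\<exists>(M' :: ('a \<times> ('n \<Rightarrow> real)) measure) (Dt :: 'n \<Rightarrow> 'a \<times> ('n \<Rightarrow> real) \<Rightarrow> 'n \<Rightarrow> bool)
           (Dt' :: 'n \<Rightarrow> 'a \<times> ('n \<Rightarrow> real) \<Rightarrow> 'n \<Rightarrow> bool).
     extends_prob_space M M' \<and>
     (\<forall>i. (AE \<omega> in M'. \<forall>j\<in>own_cluster m C i. Dt i \<omega> j \<ge> Dt' i \<omega> j) \<and>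
          indep_rv M' (count_space UNIV) (\<lambda>\<omega>. (Dt i \<omega>, Dt' i \<omega>))
            (count_space UNIV) (\<lambda>\<omega>. restrict (D (fst \<omega>)) (- own_cluster m C i)) \<and>
          distr M' (count_space UNIV) (Dt i) = cluster_law M m C St D i t \<and>
          distr M' (count_space UNIV) (Dt' i) = cluster_law M m C St D i t' \<and>
          integrable M' (\<lambda>\<omega>.
            Y i (fst \<omega>) (merge (own_cluster m C i) (- own_cluster m C i) (Dt i \<omega>, D (fst \<omega>)))
            - Y i (fst \<omega>) (merge (own_cluster m C i) (- own_cluster m C i) (Dt' i \<omega>, D (fst \<omega>))))) \<and>
     exposure_contrast M m C St D Y t t' = 1 / real CARD('n) * (\<Sum>i\<in>UNIV. \<integral>\<omega>.
       (Y i (fst \<omega>) (merge (own_cluster m C i) (- own_cluster m C i) (Dt i \<omega>, D (fst \<omega>)))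
        - Y i (fst \<omega>) (merge (own_cluster m C i) (- own_cluster m C i) (Dt' i \<omega>, D (fst \<omega>)))) \<partial>M')"
proof -
  have q: "snd t \<in> P" "snd t' \<in> P"
    using contrast levels by auto
  interpret randomized_saturation_design M m C St P D Y by (rule design)
  have pos: "prob (T_event i t) > 0" "prob (T_event i t') > 0" for i
    using overlap by auto
  have int: "integrable (given_T i t) (\<lambda>\<omega>. Y i \<omega> (D \<omega>))" "integrable (given_T i t') (\<lambda>\<omega>. Y i \<omega> (D \<omega>))" for i
    using means_exist by auto
  let ?Dt = "\<lambda>i \<omega>. draw i t (snd \<omega>)" and ?Dt' = "\<lambda>i \<omega>. draw i t' (snd \<omega>)"
  have merge: "merge (own i) (- own i) (draw i s (snd \<omega>), D (fst \<omega>)) = redraw i s (D (fst \<omega>), snd \<omega>)"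
    for i s and \<omega> :: "'a \<times> ('n \<Rightarrow> real)"
    by (simp add: redraw_def)
  have "extends_prob_space M (M \<Otimes>\<^sub>M U)"
    by (simp add: extends_prob_space_def enlarged.prob_space_axioms unif01_product.distr_pair_fst)
  moreover have "AE \<omega> in M \<Otimes>\<^sub>M U. \<forall>j\<in>own i. ?Dt i \<omega> j \<ge> ?Dt' i \<omega> j" for i
    \<comment> \<open>The order holds at every point: units other than \<open>i\<close> face a
      larger threshold under \<open>t\<close>, and the treatments of \<open>i\<close> are equal, are
      \<open>True\<close> against \<open>False\<close>, or follow the thresholds as well.\<close>
    using contrast \<open>p \<ge> p'\<close> by (intro AE_I2) (auto simp: cluster_draw_def)
  moreover have "indep_rv (M \<Otimes>\<^sub>M U) (count_space UNIV) (\<lambda>\<omega>. (?Dt i \<omega>, ?Dt' i \<omega>))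
      (count_space UNIV) (\<lambda>\<omega>. restrict (D (fst \<omega>)) (- own i))" for i
    using enlarged.indep_rv_snd_fst[of "\<lambda>u. (draw i t u, draw i t' u)" "count_space UNIV"
        "\<lambda>\<omega>. restrict (D \<omega>) (- own i)" "count_space UNIV"]
    by simp
  moreover have "distr (M \<Otimes>\<^sub>M U) (count_space UNIV) (?Dt i) = cluster_law M m C St D i t"
    "distr (M \<Otimes>\<^sub>M U) (count_space UNIV) (?Dt' i) = cluster_law M m C St D i t'" for i
    by (simp_all add: distr_draw q pos enlarged.distr_compose_snd)
  moreover have "integrable (M \<Otimes>\<^sub>M U) (\<lambda>\<omega>.
      Y i (fst \<omega>) (merge (own i) (- own i) (?Dt i \<omega>, D (fst \<omega>)))
      - Y i (fst \<omega>) (merge (own i) (- own i) (?Dt' i \<omega>, D (fst \<omega>))))" for i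
    unfolding merge using int by (intro Bochner_Integration.integrable_diff) (simp_all add: mean_redraw q pos)
  moreover have "exposure_contrast M m C St D Y t t' = 1 / real CARD('n) * (\<Sum>i\<in>UNIV. \<integral>\<omega>.
      (Y i (fst \<omega>) (merge (own i) (- own i) (?Dt i \<omega>, D (fst \<omega>)))
       - Y i (fst \<omega>) (merge (own i) (- own i) (?Dt' i \<omega>, D (fst \<omega>)))) \<partial>(M \<Otimes>\<^sub>M U))"
    \<comment> \<open>Splitting the integral of the difference requires both terms to be integrable,
      since a non-integrable function has Bochner integral 0 by convention.
      \<open>mean_redraw\<close> carries integrability over from the conditional means.\<close>
    unfolding exposure_contrast_def merge using int
    by (simp add: Bochner_Integration.integral_diff mean_redraw q pos)
  ultimately show ?thesis
    by (intro exI[of _ "M \<Otimes>\<^sub>M U"] exI[of _ ?Dt] exI[of _ ?Dt'] conjI allI)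
qed

end
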